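(* The sequence $\eta$ does not contain a fourth power, i.e. for every non-empty $w\in\mathrm{Sub}_\tau$ the inequality $\mathrm{Ind}(w)<4$ holds. In particular, $\mathrm{Ind}(\Omega_\tau)=4$.
   Context: Let $\mathcal A=\{a,x,y,z\}$ and let $\tau$ be the substitution $a\mapsto axa$, $x\mapsto y$, $y\mapsto z$, $z\mapsto x$, extended to words by concatenation. $\mathrm{Sub}_\tau$ is the set of all finite subwords (blocks of consecutive letters, including the empty word) of the words $\tau^n(s)$, $s\in\mathcal A$, $n\ge 0$. $\eta\in\mathcal A^{\mathbb N}$ is the unique one-sided infinite word having $\tau^n(a)$ as a prefix for every $n\ge0$; the set of finite subwords of $\eta$ is $\mathrm{Sub}_\tau$. $\Omega_\tau$ is the set of all $\omega\in\mathcal A^{\mathbb Z}$ all of whose finite subwords belong to $\mathrm{Sub}_\tau$. For a non-empty word $w\in\mathrm{Sub}_\tau$, a prefix $v$ of $w$ and $N\in\mathbb N=\{1,2,\dots\}$ put $\mathrm{Ind}(w,w^Nv):=N+\frac{|v|}{|w|}$, and define the index of $w$ by $\mathrm{Ind}(w):=\max\{\mathrm{Ind}(w,w^Nv): v \text{ prefix of } w,\ N\in\mathbb N,\ w^Nv\in\mathrm{Sub}_\tau\}$ (this is finite). The index of the subshift is $\mathrm{Ind}(\Omega_\tau)=\sup\{\mathrm{Ind}(w): w\in\mathrm{Sub}_\tau \text{ non-empty}\}$. *)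

theory Defs
  imports "HOL-Library.Sublist" "HOL-Library.Extended_Real"
begin

datatype letter = La | Lx | Ly | Lz

fun tau_letter :: "letter \<Rightarrow> letter list" where
  "tau_letter La = [La, Lx, La]"
| "tau_letter Lx = [Ly]"
| "tau_letter Ly = [Lz]"
| "tau_letter Lz = [Lx]"

definition tau :: "letter list \<Rightarrow> letter list" where
  "tau w = concat (map tau_letter w)"

definition Sub_tau :: "letter list set" where
  "Sub_tau = {u. \<exists>s n. sublist u ((tau ^^ n) [s])}"

(* One-sided infinite words are indexed from 0. *)
definition eta :: "nat \<Rightarrow> letter" where
  "eta = (THE e. \<forall>n. map e [0..<length ((tau ^^ n) [La])] = (tau ^^ n) [La])"

definition factors_nat :: "(nat \<Rightarrow> 'a) \<Rightarrow> 'a list set" where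
  "factors_nat e = {map e [i..<j] | i j. True}"

definition factors_int :: "(int \<Rightarrow> 'a) \<Rightarrow> 'a list set" where
  "factors_int e = {map e [i..j] | i j. True}"

definition Omega_tau :: "(int \<Rightarrow> letter) set" where
  "Omega_tau = {\<omega>. factors_int \<omega> \<subseteq> Sub_tau}"

definition word_power :: "'a list \<Rightarrow> nat \<Rightarrow> 'a list" where
  "word_power w N = concat (replicate N w)"

(* Max of an infinite set is unspecified; a bound on word_index w is meaningful because
   for non-empty w in Sub_tau the exponents N occurring here are bounded. *)
definition word_index :: "letter list \<Rightarrow> real" where
  "word_index w = Max {real N + real (length v) / real (length w) | v N.
     prefix v w \<and> 1 \<le> N \<and> word_power w N @ v \<in> Sub_tau}"

(* The index of the subshift Omega_tau. Its language is Sub_tau, see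
   language_Omega_tau below. The supremum is taken in ereal, so that the value
   is meaningful without knowing beforehand that it is finite. *)
definition index_Omega_tau :: ereal where
  "index_Omega_tau = (SUP w \<in> Sub_tau - {[]}. ereal (word_index w))"

lemma tau_append: "tau (u @ v) = tau u @ tau v"
  by (simp add: tau_def)

lemma tau_pow_append: "(tau ^^ n) (u @ v) = (tau ^^ n) u @ (tau ^^ n) v"
  by (induction n) (simp_all add: tau_append)

lemma tau_pow_Suc_a:
  "(tau ^^ Suc n) [La] = (tau ^^ n) [La] @ (tau ^^ n) [Lx] @ (tau ^^ n) [La]"
proof -
  have "(tau ^^ Suc n) [La] = (tau ^^ n) ([La] @ [Lx] @ [La])"
    by (simp add: funpow_Suc_right tau_def del: funpow.simps)
  then show ?thesis by (simp only: tau_pow_append)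
qed

lemma tau_pow_x:
  "(tau ^^ n) [Lx] = (if n mod 3 = 0 then [Lx] else if n mod 3 = 1 then [Ly] else [Lz])"
  by (induction n) (auto simp: tau_def mod_Suc)

lemma length_tau_pow_a: "n < length ((tau ^^ n) [La])"
  by (induction n) (auto simp: tau_pow_Suc_a tau_pow_x simp del: funpow.simps(2))

lemma prefix_tau_pow_a: "m \<le> n \<Longrightarrow> prefix ((tau ^^ m) [La]) ((tau ^^ n) [La])"
proof (induction n rule: dec_induct)
  case (step n)
  then show ?case by (metis prefix_order.trans prefixI tau_pow_Suc_a)
qed simp

lemma eta_ex1: "\<exists>!e. \<forall>n. map e [0..<length ((tau ^^ n) [La])] = (tau ^^ n) [La]"
proof (rule ex_ex1I)
  define e where "e = (\<lambda>i. (tau ^^ i) [La] ! i)"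
  have "map e [0..<length ((tau ^^ n) [La])] = (tau ^^ n) [La]" for n
  proof (rule nth_equalityI)
    fix i assume "i < length (map e [0..<length ((tau ^^ n) [La])])"
    then have i: "i < length ((tau ^^ n) [La])" by simp
    have "(tau ^^ i) [La] ! i = (tau ^^ n) [La] ! i"
    proof (cases "i \<le> n")
      case True
      from prefix_tau_pow_a[OF this] show ?thesis
        using length_tau_pow_a[of i] by (auto elim!: prefixE simp: nth_append)
    next
      case False
      then have "prefix ((tau ^^ n) [La]) ((tau ^^ i) [La])"
        by (intro prefix_tau_pow_a) simp
      then show ?thesis using i by (auto elim!: prefixE simp: nth_append)
    qed
    then show "map e [0..<length ((tau ^^ n) [La])] ! i = (tau ^^ n) [La] ! i"
      using i by (simp add: e_def)
  qed simp
  then show "\<exists>e. \<forall>n. map e [0..<length ((tau ^^ n) [La])] = (tau ^^ n) [La]" by blast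
next
  fix e e' :: "nat \<Rightarrow> letter"
  assume *: "\<forall>n. map e [0..<length ((tau ^^ n) [La])] = (tau ^^ n) [La]"
    and **: "\<forall>n. map e' [0..<length ((tau ^^ n) [La])] = (tau ^^ n) [La]"
  show "e = e'"
  proof
    fix i
    from * ** have "map e [0..<length ((tau ^^ i) [La])] = map e' [0..<length ((tau ^^ i) [La])]"
      by simp
    then show "e i = e' i" using length_tau_pow_a[of i] by simp
  qed
qed

lemma eta_prefix: "map eta [0..<length ((tau ^^ n) [La])] = (tau ^^ n) [La]"
  using theI'[OF eta_ex1] unfolding eta_def by blast

lemma Sub_tau_in_tau_pow_a:
  assumes "u \<in> Sub_tau"
  shows "\<exists>n. sublist u ((tau ^^ n) [La])"
proof -
  obtain s n where u: "sublist u ((tau ^^ n) [s])"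
    using assms by (auto simp: Sub_tau_def)
  have "sublist [s] ((tau ^^ 3) [La])"
    by (cases s) (auto simp: numeral_3_eq_3 tau_def sublist_Cons_right)
  then obtain p q where "(tau ^^ 3) [La] = p @ [s] @ q" by (auto simp: sublist_def)
  then have "(tau ^^ (n + 3)) [La] = (tau ^^ n) p @ (tau ^^ n) [s] @ (tau ^^ n) q"
    by (simp add: funpow_add tau_pow_append[symmetric])
  then have "sublist ((tau ^^ n) [s]) ((tau ^^ (n + 3)) [La])"
    by (metis sublist_appendI)
  with u show ?thesis using sublist_order.order.trans by blast
qed

lemma language_eta: "factors_nat eta = Sub_tau"
proof (intro equalityI subsetI)
  fix u assume "u \<in> factors_nat eta"
  then obtain i j where u: "u = map eta [i..<j]" by (auto simp: factors_nat_def)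
  define L where "L = length ((tau ^^ j) [La])"
  have "u = drop i (take j (map eta [0..<L]))"
    using length_tau_pow_a[of j] by (simp add: u take_map drop_map L_def)
  then have "u = drop i (take j ((tau ^^ j) [La]))"
    using eta_prefix by (simp add: L_def)
  then have "sublist u ((tau ^^ j) [La])"
    by (metis sublist_drop sublist_take sublist_order.order.trans)
  then show "u \<in> Sub_tau" by (auto simp: Sub_tau_def)
next
  fix u assume "u \<in> Sub_tau"
  then obtain n p q where *: "(tau ^^ n) [La] = p @ u @ q"
    using Sub_tau_in_tau_pow_a by (metis sublist_def)
  define L where "L = length ((tau ^^ n) [La])"
  have "u = drop (length p) (take (length p + length u) (map eta [0..<L]))"
    using eta_prefix[of n] * by (simp add: L_def)
  also have "\<dots> = map eta [length p..<length p + length u]"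
    using * by (simp add: take_map drop_map L_def)
  finally show "u \<in> factors_nat eta" by (auto simp: factors_nat_def)
qed

lemma rev_tau_pow_a: "rev ((tau ^^ n) [La]) = (tau ^^ n) [La]"
  by (induction n) (auto simp: tau_pow_Suc_a tau_pow_x simp del: funpow.simps(2))

lemma language_Omega_tau: "(\<Union>\<omega>\<in>Omega_tau. factors_int \<omega>) = Sub_tau"
proof
  show "(\<Union>\<omega>\<in>Omega_tau. factors_int \<omega>) \<subseteq> Sub_tau" by (auto simp: Omega_tau_def)
  define \<omega> :: "int \<Rightarrow> letter" where
    "\<omega> = (\<lambda>i. if i = 0 then Lx else if i > 0 then eta (nat (i - 1)) else eta (nat (- i - 1)))"
  have centre: "map \<omega> [- int L..int L] = (tau ^^ Suc n) [La]"
    if n: "n mod 3 = 0" and L: "L = length ((tau ^^ n) [La])" for n L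
  proof -
    have split: "[- int L..int L] = [- int L..- 1] @ [0] @ [1..int L]"
      using upto_split1[of "- int L" 0 "int L"] upto_split2[of "- int L" 0 "int L"]
        upto_split3[of "- int L" 0 "int L"] by simp
    have right: "map \<omega> [1..int L] = (tau ^^ n) [La]"
    proof -
      have "map \<omega> [1..int L] = map eta [0..<L]"
        by (rule nth_equalityI) (auto simp: \<omega>_def)
      then show ?thesis using eta_prefix[of n] by (simp add: L)
    qed
    have "map \<omega> [- int L..- 1] = rev (map eta [0..<L])"
      by (rule nth_equalityI) (auto simp: \<omega>_def rev_nth nat_diff_distrib intro!: arg_cong[where f = eta])
    then have left: "map \<omega> [- int L..- 1] = (tau ^^ n) [La]"
      using eta_prefix[of n] by (simp add: L rev_tau_pow_a)
    have "\<omega> 0 = Lx" by (simp add: \<omega>_def)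
    then show ?thesis using n by (simp add: split left right tau_pow_Suc_a tau_pow_x del: funpow.simps)
  qed
  have "factors_int \<omega> \<subseteq> Sub_tau"
  proof
    fix u assume "u \<in> factors_int \<omega>"
    then obtain i j where u: "u = map \<omega> [i..j]" by (auto simp: factors_int_def)
    define n where "n = 3 * nat (\<bar>i\<bar> + \<bar>j\<bar>)"
    define L where "L = length ((tau ^^ n) [La])"
    have L: "\<bar>i\<bar> + \<bar>j\<bar> < int L" using length_tau_pow_a[of n, folded L_def] unfolding n_def by linarith
    have "sublist [i..j] [- int L..int L]"
    proof (cases "i \<le> j")
      case True
      have "[- int L..int L] = [- int L..i - 1] @ [i..int L]"
        using L by (intro upto_split1) auto
      also have "[i..int L] = [i..j] @ [j + 1..int L]"
        using L True by (intro upto_split2) auto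
      finally show ?thesis by (metis sublist_appendI)
    qed simp
    then have "sublist u (map \<omega> [- int L..int L])" unfolding u by (rule map_mono_sublist)
    moreover have "map \<omega> [- int L..int L] = (tau ^^ Suc n) [La]"
      by (rule centre[OF _ L_def]) (simp add: n_def)
    ultimately have "sublist u ((tau ^^ Suc n) [La])" by simp
    then show "u \<in> Sub_tau" unfolding Sub_tau_def by blast
  qed
  then have "\<omega> \<in> Omega_tau" by (simp add: Omega_tau_def)
  moreover have "Sub_tau \<subseteq> factors_int \<omega>"
  proof
    fix u assume "u \<in> Sub_tau"
    then obtain i j where u: "u = map eta [i..<j]"
      by (auto simp: language_eta[symmetric] factors_nat_def)
    have "u = map \<omega> [int i + 1..int j]"
      unfolding u by (rule nth_equalityI) (auto simp: \<omega>_def nat_add_distrib)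
    then show "u \<in> factors_int \<omega>" by (auto simp: factors_int_def)
  qed
  ultimately show "Sub_tau \<subseteq> (\<Union>\<omega>\<in>Omega_tau. factors_int \<omega>)" by blast
qed

end

theory Submission
  imports Defs
begin

text \<open>The word \<open>eta\<close> is a Toeplitz word: counting positions from 1, the letter at a position
  \<open>2 ^ k * q\<close> with \<open>q\<close> odd depends on \<open>k\<close> alone, and it differs from the letter for \<open>Suc k\<close>.
  A fourth power of period \<open>l = 2 ^ k * q\<close>, \<open>q\<close> odd, covers \<open>4 * l \<ge> 2 ^ (k + 2)\<close> consecutive
  positions, hence a position \<open>2 ^ Suc k * r\<close> with \<open>r\<close> odd. Moving by \<open>l\<close> inside the
  fourth power leads to a position \<open>2 ^ k * (2 * r \<plusminus> q)\<close>, which carries a different letter.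
  Conversely, \<open>p n = (tau ^^ n) [La]\<close> satisfies \<open>p (Suc n) = p n @ s n @ p n\<close> with one-letter
  words \<open>s n\<close> of period 3 in \<open>n\<close>, so \<open>p (n + 4)\<close> has the factor
  \<open>p (Suc n) @ s n @ p (Suc n)\<close>, which is \<open>p n @ s n\<close> to the power \<open>4 - 1 / length (p n @ s n)\<close>.\<close>

section \<open>Toeplitz structure of \<open>eta\<close>\<close>

definition toeplitz_letter :: "nat \<Rightarrow> letter" where
  "toeplitz_letter k =
    (if k = 0 then La else if k mod 3 = 1 then Lx else if k mod 3 = 2 then Ly else Lz)"

lemma toeplitz_letter_Suc_neq: "toeplitz_letter (Suc k) \<noteq> toeplitz_letter k"
  by (auto simp: toeplitz_letter_def mod_Suc split: if_splits)

lemma tau_pow_x_toeplitz: "(tau ^^ n) [Lx] = [toeplitz_letter (Suc n)]"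
proof -
  have "n mod 3 = 0 \<or> n mod 3 = 1 \<or> n mod 3 = 2" by linarith
  then show ?thesis by (auto simp: tau_pow_x toeplitz_letter_def mod_Suc)
qed

lemma Suc_length_tau_pow_a: "Suc (length ((tau ^^ n) [La])) = 2 ^ Suc n"
  by (induction n) (auto simp: tau_pow_Suc_a tau_pow_x_toeplitz simp del: funpow.simps(2))

text \<open>By induction along \<open>p (Suc n) = p n @ s n @ p n\<close>: counted from 1, the
  middle letter has position \<open>2 ^ Suc n\<close>. Positions in the right half shift back by
  this amount, which for \<open>k \<le> n\<close> changes \<open>q\<close> by an even number and so
  keeps it odd; \<open>k = Suc n\<close> can only be the middle itself.\<close>

lemma tau_pow_a_nth:
  assumes "odd q" "2 ^ k * q < (2::nat) ^ Suc n"
  shows "(tau ^^ n) [La] ! (2 ^ k * q - 1) = toeplitz_letter k"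
  using assms
proof (induction n arbitrary: q)
  case 0
  have "0 < 2 ^ k * q" using 0 by (simp add: odd_pos)
  moreover have "2 ^ k * q < 2" using 0(2) by (simp only: power_Suc0_right)
  ultimately have "2 ^ k * q = 1" by linarith
  then show ?case by (auto simp: toeplitz_letter_def)
next
  case (Suc n)
  define L where "L = length ((tau ^^ n) [La])"
  have L: "Suc L = 2 ^ Suc n" using Suc_length_tau_pow_a L_def by simp
  have q: "q > 0" using Suc.prems(1) by (rule odd_pos)
  then have pos: "0 < 2 ^ k * q" by simp
  have split: "(tau ^^ Suc n) [La]
      = (tau ^^ n) [La] @ toeplitz_letter (Suc n) # (tau ^^ n) [La]"
    by (simp add: tau_pow_Suc_a tau_pow_x_toeplitz del: funpow.simps)
  show ?case
  proof (cases "k \<le> n")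
    case True
    define e :: nat where "e = 2 ^ (Suc n - k)"
    have ke: "2 ^ k * e = Suc L" using True by (simp add: e_def L flip: power_add)
    have "even e" using True by (simp add: e_def)
    then have "q \<noteq> e" using Suc.prems(1) by auto
    then consider "q < e" | "e < q" by linarith
    then show ?thesis
    proof cases
      case 1
      then have less: "2 ^ k * q < Suc L" by (simp flip: ke)
      then have "(tau ^^ n) [La] ! (2 ^ k * q - 1) = toeplitz_letter k"
        using Suc.IH[OF Suc.prems(1)] L by simp
      moreover have "2 ^ k * q - 1 < L" using less pos by linarith
      ultimately show ?thesis by (simp add: split nth_append L_def del: funpow.simps)
    next
      case 2
      define r where "r = q - e"
      have r: "q = e + r" "odd r" "0 < r"
        using 2 Suc.prems(1) \<open>even e\<close> by (auto simp: r_def)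
      have eq: "2 ^ k * q = Suc L + 2 ^ k * r" by (simp add: r(1) distrib_left ke)
      then have "2 ^ k * r < 2 ^ Suc n" using Suc.prems(2) L by simp
      then have "(tau ^^ n) [La] ! (2 ^ k * r - 1) = toeplitz_letter k"
        by (rule Suc.IH[OF r(2)])
      \<comment> \<open>The \<open>Suc\<close> steps over the middle letter, so that
        \<open>nth_append\<close> reaches the right copy.\<close>
      moreover have "2 ^ k * q - 1 = L + Suc (2 ^ k * r - 1)" using eq r(3) by simp
      ultimately show ?thesis by (simp add: split nth_append L_def del: funpow.simps)
    qed
  next
    case False
    have "2 ^ k * 1 \<le> 2 ^ k * q" using q by (intro mult_le_mono2) simp
    then have "(2::nat) ^ k < 2 ^ Suc (Suc n)" using Suc.prems(2) by linarith
    then have "k < Suc (Suc n)" by (rule power_less_imp_less_exp[rotated]) simp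
    then have k: "k = Suc n" using False by simp
    then have "2 ^ Suc n * q < 2 ^ Suc n * 2" using Suc.prems(2) by simp
    then have "q < 2" by (rule mult_less_cancel1[THEN iffD1, THEN conjunct2])
    then have "q = 1" using q by linarith
    then have "2 ^ k * q - 1 = L" using k L by simp
    then show ?thesis by (simp add: split nth_append L_def k del: funpow.simps)
  qed
qed

lemma eta_toeplitz:
  assumes "odd q"
  shows "eta (2 ^ k * q - 1) = toeplitz_letter k"
proof -
  \<comment> \<open>The position itself serves as the exponent: crude, but
    \<open>(tau ^^ n) [La]\<close> is longer than \<open>n\<close>.\<close>
  define n where "n = 2 ^ k * q"
  have "n < 2 ^ Suc n" using less_exp[of "Suc n"] by linarith
  have "0 < n" using assms by (simp add: n_def odd_pos)
  then have "n - 1 < length ((tau ^^ n) [La])" using length_tau_pow_a[of n] by linarith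
  then have "eta (n - 1) = (tau ^^ n) [La] ! (n - 1)"
    using arg_cong[OF eta_prefix[of n], of "\<lambda>u. u ! (n - 1)"] by simp
  also have "\<dots> = toeplitz_letter k"
    using tau_pow_a_nth[OF assms, of k n] \<open>n < 2 ^ Suc n\<close> by (simp add: n_def)
  finally show ?thesis by (simp add: n_def)
qed

section \<open>Absence of fourth powers\<close>

lemma odd_multiple_between:
  fixes d i :: nat
  assumes "0 < d"
  obtains r where "odd r" "i < d * r" "d * r \<le> i + 2 * d"
proof -
  define c where "c = i div d"
  have c: "d * c \<le> i" "i < d * Suc c"
    using assms by (auto simp: c_def dividend_less_times_div)
  \<comment> \<open>The next two multiples of \<open>d\<close> above \<open>i\<close> have cofactors
    of opposite parity, and the second is at most \<open>i + 2 * d\<close>.\<close>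
  show thesis
  proof (cases "even c")
    case True
    with c show thesis by (intro that[of "Suc c"]) auto
  next
    case False
    with c show thesis by (intro that[of "Suc (Suc c)"]) auto
  qed
qed

lemma eta_no_long_period:
  assumes "0 < l" and period: "\<And>t. t < 3 * l \<Longrightarrow> eta (i + t + l) = eta (i + t)"
  shows False
proof -
  obtain k q where l: "l = 2 ^ k * q" and "odd q"
    using \<open>0 < l\<close>
  proof (induction l arbitrary: thesis rule: less_induct)
    case (less l)
    show ?case
    proof (cases "even l")
      case True
      then obtain h where "l = 2 * h" by blast
      moreover from this obtain k q where "h = 2 ^ k * q" "odd q"
        using less.IH[of h] less.prems(2) by auto
      ultimately show ?thesis using less.prems(1)[of "Suc k" q] by simp
    next
      case False
      then show ?thesis using less.prems(1)[of 0 l] by simp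
    qed
  qed
  obtain r where r: "odd r" "i < 2 ^ Suc k * r" "2 ^ Suc k * r \<le> i + 2 * 2 ^ Suc k"
    by (rule odd_multiple_between[of "2 ^ Suc k" i]) auto
  have "2 ^ k * 1 \<le> l" unfolding l using odd_pos[OF \<open>odd q\<close>] by (intro mult_le_mono2) simp
  with r(3) have r_le: "2 ^ Suc k * r \<le> i + 4 * l" by simp
  \<comment> \<open>\<open>t\<close> is the offset in the window of \<open>4 * l\<close> letters
    starting at index \<open>i\<close>; the \<open>- 1\<close> turns a position counted from 1 into
    an index of \<open>eta\<close>.\<close>
  define t where "t = 2 ^ Suc k * r - 1 - i"
  have t: "2 ^ Suc k * r - 1 = i + t" "t < 4 * l" using r(2) r_le by (auto simp: t_def)
  have at_t: "eta (i + t) = toeplitz_letter (Suc k)" using eta_toeplitz[OF r(1), of "Suc k"] t by simp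
  show False
  proof (cases "t < 3 * l")
    case True
    have "2 ^ k * (2 * r + q) - 1 = i + t + l"
      using t(1) r(2) by (simp add: l distrib_left mult.assoc mult.left_commute)
    then have "eta (i + t + l) = toeplitz_letter k"
      using eta_toeplitz[of "2 * r + q" k] \<open>odd q\<close> by simp
    then show False using period[OF True] at_t toeplitz_letter_Suc_neq by metis
  next
    case False
    \<comment> \<open>No room is guaranteed to the right of \<open>t\<close>, so the shift by
      \<open>l\<close> goes left.\<close>
    define u where "u = t - l"
    have u: "t = u + l" "u < 3 * l" using False t(2) by (auto simp: u_def)
    have eq: "2 ^ k * (2 * r) = Suc (i + u + l)"
      using t(1) r(2) u(1) by simp
    then have "2 ^ k * q < 2 ^ k * (2 * r)" by (simp add: l)
    then have "q < 2 * r" by simp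
    moreover have "2 ^ k * (2 * r - q) - 1 = i + u"
      unfolding diff_mult_distrib2 eq by (simp add: l)
    ultimately have "eta (i + u) = toeplitz_letter k"
      using eta_toeplitz[of "2 * r - q" k] \<open>odd q\<close> by simp
    then show False using period[OF u(2)] at_t u(1) toeplitz_letter_Suc_neq
      by (metis add.assoc)
  qed
qed

lemma word_power_4: "word_power w 4 = w @ w @ w @ w"
  by (simp add: word_power_def numeral_eq_Suc)

lemma no_fourth_power_eta:
  assumes "w \<noteq> []" shows "word_power w 4 \<notin> factors_nat eta"
proof
  assume "word_power w 4 \<in> factors_nat eta"
  then obtain i j where ij: "w @ w @ w @ w = map eta [i..<j]"
    by (auto simp: factors_nat_def word_power_4)
  have len: "4 * length w = j - i" using arg_cong[OF ij, of length] by simp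
  have nth: "eta (i + t) = (w @ w @ w @ w) ! t" if "t < 4 * length w" for t
    using that len by (simp add: ij)
  have "eta (i + t + length w) = eta (i + t)" if "t < 3 * length w" for t
  proof -
    have "(w @ w @ w @ w) ! (t + length w) = (w @ w @ w) ! t" by (simp add: nth_append)
    moreover have "((w @ w @ w) @ w) ! t = (w @ w @ w) ! t"
      using that by (subst nth_append) simp
    ultimately show ?thesis
      using nth[of t] nth[of "t + length w"] that by (simp add: add.assoc)
  qed
  with assms show False by (intro eta_no_long_period[of "length w" i]) auto
qed

section \<open>Exponents of powers in \<open>Sub_tau\<close>\<close>

lemma Sub_tau_sublist: "\<lbrakk>u \<in> Sub_tau; sublist v u\<rbrakk> \<Longrightarrow> v \<in> Sub_tau"
  unfolding Sub_tau_def using sublist_order.order.trans by blast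

lemma no_fourth_power_Sub_tau: "w \<noteq> [] \<Longrightarrow> w @ w @ w @ w \<notin> Sub_tau"
  using no_fourth_power_eta[of w] by (simp add: language_eta word_power_4)

lemma power_in_Sub_tau_bounds:
  assumes "w \<noteq> []" "prefix v w" "word_power w N @ v \<in> Sub_tau"
  shows "N \<le> 3" "N = 3 \<longrightarrow> length v < length w"
proof -
  show "N \<le> 3"
  proof (rule ccontr)
    assume "\<not> N \<le> 3"
    then obtain M where "N = 4 + M" using le_Suc_ex[of 4 N] by auto
    then have "word_power w N @ v = word_power w 4 @ word_power w M @ v"
      by (simp add: word_power_def replicate_add)
    then have "sublist (word_power w 4) (word_power w N @ v)" by simp
    then show False
      using assms Sub_tau_sublist no_fourth_power_Sub_tau by (metis word_power_4)
  qed
  show "N = 3 \<longrightarrow> length v < length w"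
  proof (intro impI, rule ccontr)
    assume "N = 3" "\<not> length v < length w"
    moreover from this have "v = w"
      using prefix_length_less[of v w] assms(2) by (auto simp: strict_prefix_def)
    ultimately show False
      using assms no_fourth_power_Sub_tau by (simp add: word_power_def numeral_eq_Suc)
  qed
qed

abbreviation word_exponents :: "letter list \<Rightarrow> real set" where
  "word_exponents w \<equiv> {real N + real (length v) / real (length w) | v N.
     prefix v w \<and> 1 \<le> N \<and> word_power w N @ v \<in> Sub_tau}"

text \<open>Makes the \<open>Max\<close> in \<open>word_index\<close> a genuine maximum: only
  finitely many prefixes and \<open>N \<le> 3\<close> are possible.\<close>

lemma finite_word_exponents:
  assumes "w \<noteq> []" shows "finite (word_exponents w)"
proof (rule finite_subset)
  show "word_exponents w \<subseteq>
      (\<lambda>(v, N). real N + real (length v) / real (length w)) ` (set (prefixes w) \<times> {..3})"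
    using power_in_Sub_tau_bounds(1)[OF assms] by force
qed simp

lemma word_exponents_less_4:
  assumes "w \<noteq> []" "e \<in> word_exponents w"
  shows "e < 4"
proof -
  obtain v N where e: "e = real N + real (length v) / real (length w)"
    and v: "prefix v w" "word_power w N @ v \<in> Sub_tau"
    using assms(2) by blast
  note N = power_in_Sub_tau_bounds[OF assms(1) v]
  have len: "length v \<le> length w" using v(1) by (rule prefix_length_le)
  show ?thesis
  proof (cases "N = 3")
    case True
    with N(2) have "real (length v) / real (length w) < 1" by (simp add: divide_less_eq)
    with True e show ?thesis by simp
  next
    case False
    with N(1) have "real N \<le> 2" by simp
    moreover have "real (length v) / real (length w) \<le> 1" using len by (simp add: divide_le_eq)
    ultimately show ?thesis using e by linarith
  qed
qed

lemma word_index_less_4: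
  assumes "w \<in> Sub_tau" "w \<noteq> []" shows "word_index w < 4"
proof -
  have "word_power w 1 @ [] \<in> Sub_tau" using assms(1) by (simp add: word_power_def)
  then have "real 1 + real (length []) / real (length w) \<in> word_exponents w"
    by (intro CollectI exI[of _ "[]"] exI[of _ 1]) simp
  \<comment> \<open>With finiteness, the maximum is attained, so the strict bound on each exponent
    passes to it.\<close>
  then have "word_exponents w \<noteq> {}" by blast
  then have "word_index w \<in> word_exponents w"
    unfolding word_index_def using finite_word_exponents[OF assms(2)] by (rule Max_in[rotated])
  with assms(2) show ?thesis by (rule word_exponents_less_4)
qed

section \<open>Words of index close to 4\<close>

lemma ex_word_index_close_to_4:
  "\<exists>w \<in> Sub_tau - {[]}. 4 - 1 / real (Suc n) \<le> word_index w"
proof -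
  define p where "p = (\<lambda>m. (tau ^^ m) [La])"
  define s where "s = (tau ^^ n) [Lx]"
  define w where "w = p n @ s"
  have p_n: "n < length (p n)" unfolding p_def by (rule length_tau_pow_a)
  have s: "length s = 1" by (simp add: s_def tau_pow_x_toeplitz)
  have p_Suc: "p (Suc n) = p n @ s @ p n" unfolding p_def s_def by (rule tau_pow_Suc_a)
  \<comment> \<open>The period 3 puts \<open>s\<close> in the middle of \<open>p (n + 4)\<close>,
    between two copies of \<open>p (n + 3)\<close> that end and begin with
    \<open>p (Suc n)\<close>.\<close>
  have s_3: "(tau ^^ (n + 3)) [Lx] = s" by (simp add: s_def tau_pow_x del: funpow.simps)
  have p_4: "p (Suc (n + 3)) = p (n + 3) @ s @ p (n + 3)"
    unfolding p_def tau_pow_Suc_a s_3 ..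
  have "prefix (p (Suc n)) (p (n + 3))" unfolding p_def by (rule prefix_tau_pow_a) simp
  then obtain u where u: "p (n + 3) = p (Suc n) @ u" by (rule prefixE)
  \<comment> \<open>The words \<open>p m\<close> are palindromes, so the prefix is also a suffix.\<close>
  have "p (n + 3) = rev (p (n + 3))" by (simp add: p_def rev_tau_pow_a del: funpow.simps)
  also have "\<dots> = rev u @ p (Suc n)" unfolding u by (simp add: p_def rev_tau_pow_a del: funpow.simps)
  finally have "p (Suc (n + 3)) = rev u @ (p (Suc n) @ s @ p (Suc n)) @ u"
    unfolding p_4 using u by simp
  then have "sublist (p (Suc n) @ s @ p (Suc n)) (p (Suc (n + 3)))"
    by (simp only: sublist_appendI)
  moreover have "word_power w 3 @ p n = p (Suc n) @ s @ p (Suc n)"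
    by (simp add: word_power_def numeral_eq_Suc w_def p_Suc)
  ultimately have in_Sub: "word_power w 3 @ p n \<in> Sub_tau"
    unfolding Sub_tau_def p_def by auto
  have "sublist w (word_power w 3 @ p n)" by (simp add: word_power_def numeral_eq_Suc)
  with in_Sub have "w \<in> Sub_tau" by (rule Sub_tau_sublist)
  moreover have w: "w \<noteq> []" using s by (auto simp: w_def)
  moreover have "4 - 1 / real (Suc n) \<le> word_index w"
  proof -
    have len: "real (length w) = real (length (p n)) + 1" by (simp add: w_def s)
    have "4 - 1 / real (Suc n) \<le> 4 - 1 / real (length w)"
      using p_n by (simp add: len frac_le)
    also have "\<dots> = real 3 + real (length (p n)) / real (length w)"
      by (simp add: len field_simps)
    also have "\<dots> \<le> word_index w"
      unfolding word_index_def
    proof (rule Max_ge[OF finite_word_exponents[OF w]])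
      have "prefix (p n) w" by (simp add: w_def)
      with in_Sub show "real 3 + real (length (p n)) / real (length w) \<in> word_exponents w"
        by (intro CollectI exI[of _ "p n"] exI[of _ 3]) simp
    qed
    finally show ?thesis .
  qed
  ultimately show ?thesis by blast
qed

lemma index_Omega_tau_eq_4: "index_Omega_tau = 4"
proof (rule antisym)
  show "index_Omega_tau \<le> 4"
    unfolding index_Omega_tau_def
  proof (rule SUP_least)
    fix w assume "w \<in> Sub_tau - {[]}"
    then have "word_index w \<le> 4" using word_index_less_4 by (simp add: less_imp_le)
    then show "ereal (word_index w) \<le> 4" by simp
  qed
  \<comment> \<open>No single word reaches index 4, so the supremum is bounded below by a sequence
    tending to 4.\<close>
  have lower: "ereal (4 - 1 / real (Suc n)) \<le> index_Omega_tau" for n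
  proof -
    obtain w where "w \<in> Sub_tau - {[]}" "4 - 1 / real (Suc n) \<le> word_index w"
      using ex_word_index_close_to_4 by blast
    then show ?thesis
      unfolding index_Omega_tau_def by (intro SUP_upper2[of w]) auto
  qed
  have "(\<lambda>n. 4 - 1 / real (Suc n)) \<longlonglongrightarrow> 4 - 0"
    by (intro tendsto_diff tendsto_const lim_1_over_n[THEN LIMSEQ_Suc])
  then have "(\<lambda>n. ereal (4 - 1 / real (Suc n))) \<longlonglongrightarrow> 4" by simp
  from LIMSEQ_le_const2[OF this] lower show "4 \<le> index_Omega_tau" by blast
qed

theorem theorem2p14:
  shows "(\<nexists>w. w \<noteq> [] \<and> word_power w 4 \<in> factors_nat eta)
    \<and> (\<forall>w \<in> Sub_tau. w \<noteq> [] \<longrightarrow> word_index w < 4)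
    \<and> index_Omega_tau = 4"
  using no_fourth_power_eta word_index_less_4 index_Omega_tau_eq_4 by blast

end
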